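(* Let $\mathcal O\subseteq\mathbb C$ be a subring containing $1$. The binary operation $\star$ on $\overline{\mathrm{PCF}}(\mathcal O)$ defined below is well defined, and $(\overline{\mathrm{PCF}}(\mathcal O),\star)$ is a group isomorphic to $\overline{\mathrm{FCF}}(\mathcal O)\cong \mathbf Z/2\mathbf Z\ast\mathcal O$. More precisely, the map $W_{\mathsf P}:\mathrm{PCF}(\mathcal O)\to\mathbf Z/2\mathbf Z\ast\mathcal O$ induces a group isomorphism $\overline{W}_{\mathsf P}:\overline{\mathrm{PCF}}(\mathcal O)\xrightarrow{\ \simeq\ }\mathbf Z/2\mathbf Z\ast\mathcal O$.
   Context: $\mathcal O$ is viewed as an additive group, and $\mathbf Z/2\mathbf Z\ast\mathcal O$ is the free product, with $j$ the generator of $\mathbf Z/2\mathbf Z$. $\mathrm{FCF}(\mathcal O)$ is the set of finite sequences (words) $[c_1,\dots,c_n]$ with $c_i\in\mathcal O$, with concatenation as product. The equivalence relation $\sim$ on $\mathrm{FCF}(\mathcal O)$ is the one generated by $u\,[x,0,y]\,v\sim u\,[x+y]\,v$ for all words $u,v$ and $x,y\in\mathcal O$; $\overline{\mathrm{FCF}}(\mathcal O)$ is the set of classes with the operation induced by concatenation. Let $W_{\mathsf F}:\mathrm{FCF}(\mathcal O)\to\mathbf Z/2\mathbf Z\ast\mathcal O$, $W_{\mathsf F}([x_1,\dots,x_n])=x_1jx_2j\cdots x_nj$. A periodic continued fraction (PCF) over $\mathcal O$ of type $(N,k)$ ($N\ge0$, $k\ge1$), written $P=[b_1,\dots,b_N,\overline{a_1,\dots,a_k}]$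 with $b_i,a_i\in\mathcal O$, is the infinite sequence of partial quotients $b_1,\dots,b_N,a_1,\dots,a_k,a_1,\dots,a_k,\dots$ together with its type; $\mathrm{PCF}(\mathcal O)$ is the set of these. A PCF of type $(0,k)$ is a repeating continued fraction (RCF). Define $\mathsf{SF}(P)=[b_1,\dots,b_N,a_1,\dots,a_k,0,-b_N,\dots,-b_1,0]$ if $N>0$ and $\mathsf{SF}(P)=[a_1,\dots,a_k]$ if $N=0$, and $\mathsf{SR}([c_1,\dots,c_n])=[\overline{c_1,\dots,c_n}]$ (type $(0,n)$). Set $W_{\mathsf P}=W_{\mathsf F}\circ\mathsf{SF}$. For $P,P'\in\mathrm{PCF}(\mathcal O)$, $P\sim P'$ means $\mathsf{SF}(P)\sim\mathsf{SF}(P')$ (equivalently $W_{\mathsf P}(P)=W_{\mathsf P}(P')$); $\overline{\mathrm{PCF}}(\mathcal O)=\mathrm{PCF}(\mathcal O)/\sim$, and $\overline P$ denotes the class of $P$. The operation is $\overline P\star\overline{P'}:=$ the class of $\mathsf{SR}(\mathsf{SF}(P)\,\mathsf{SF}(P'))$, the RCF whose repeating block is the concatenation of $\mathsf{SF}(P)$ and $\mathsf{SF}(P')$. *)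

theory Defs
  imports Complex_Main "HOL-Algebra.Algebra" "HOL-Algebra.Algebraic_Closure_Type"
begin

section \<open>Free products of groups\<close>

text \<open>
  The free product of G and H is the monoid of words in the disjoint union of the two carriers,
  modulo the congruence generated by multiplying adjacent letters from the same factor and
  deleting identity letters.
\<close>

inductive_set free_product_rel ::
  "('a, 'm) monoid_scheme \<Rightarrow> ('b, 'n) monoid_scheme \<Rightarrow> (('a + 'b) list \<times> ('a + 'b) list) set"
  for G :: "('a, 'm) monoid_scheme" and H :: "('b, 'n) monoid_scheme"
where
  refl: "w \<in> lists (carrier G <+> carrier H) \<Longrightarrow> (w, w) \<in> free_product_rel G H"
| sym: "(v, w) \<in> free_product_rel G H \<Longrightarrow> (w, v) \<in> free_product_rel G H"
| trans: "\<lbrakk>(u, v) \<in> free_product_rel G H; (v, w) \<in> free_product_rel G H\<rbrakk>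
    \<Longrightarrow> (u, w) \<in> free_product_rel G H"
| mult_left: "\<lbrakk>u \<in> lists (carrier G <+> carrier H); v \<in> lists (carrier G <+> carrier H);
      x \<in> carrier G; y \<in> carrier G\<rbrakk>
    \<Longrightarrow> (u @ [Inl x, Inl y] @ v, u @ [Inl (x \<otimes>\<^bsub>G\<^esub> y)] @ v) \<in> free_product_rel G H"
| mult_right: "\<lbrakk>u \<in> lists (carrier G <+> carrier H); v \<in> lists (carrier G <+> carrier H);
      x \<in> carrier H; y \<in> carrier H\<rbrakk>
    \<Longrightarrow> (u @ [Inr x, Inr y] @ v, u @ [Inr (x \<otimes>\<^bsub>H\<^esub> y)] @ v) \<in> free_product_rel G H"
| one_left: "\<lbrakk>u \<in> lists (carrier G <+> carrier H); v \<in> lists (carrier G <+> carrier H)\<rbrakk>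
    \<Longrightarrow> (u @ [Inl \<one>\<^bsub>G\<^esub>] @ v, u @ v) \<in> free_product_rel G H"
| one_right: "\<lbrakk>u \<in> lists (carrier G <+> carrier H); v \<in> lists (carrier G <+> carrier H)\<rbrakk>
    \<Longrightarrow> (u @ [Inr \<one>\<^bsub>H\<^esub>] @ v, u @ v) \<in> free_product_rel G H"

definition free_product ::
  "('a, 'm) monoid_scheme \<Rightarrow> ('b, 'n) monoid_scheme \<Rightarrow> ('a + 'b) list set monoid"
where
  "free_product G H =
     \<lparr>carrier = lists (carrier G <+> carrier H) // free_product_rel G H,
      monoid.mult = (\<lambda>A B. \<Union>u\<in>A. \<Union>v\<in>B. free_product_rel G H `` {u @ v}),
      one = free_product_rel G H `` {[]}\<rparr>"

definition free_product_inl ::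
  "('a, 'm) monoid_scheme \<Rightarrow> ('b, 'n) monoid_scheme \<Rightarrow> 'a \<Rightarrow> ('a + 'b) list set"
where "free_product_inl G H x = free_product_rel G H `` {[Inl x]}"

definition free_product_inr ::
  "('a, 'm) monoid_scheme \<Rightarrow> ('b, 'n) monoid_scheme \<Rightarrow> 'b \<Rightarrow> ('a + 'b) list set"
where "free_product_inr G H y = free_product_rel G H `` {[Inr y]}"


section \<open>The group \<open>Z/2Z * O\<close>\<close>

abbreviation complex_ring :: "complex ring"
  where "complex_ring \<equiv> ring_of_type_algebra"

abbreviation additive_group :: "complex set \<Rightarrow> complex monoid"
  where "additive_group \<O> \<equiv> add_monoid (complex_ring\<lparr>carrier := \<O>\<rparr>)"

abbreviation Z2_free_product :: "complex set \<Rightarrow> (int + complex) list set monoid"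
  where "Z2_free_product \<O> \<equiv> free_product (integer_mod_group 2) (additive_group \<O>)"

definition j_gen :: "complex set \<Rightarrow> (int + complex) list set"
  where "j_gen \<O> = free_product_inl (integer_mod_group 2) (additive_group \<O>) 1"

definition ring_elt :: "complex set \<Rightarrow> complex \<Rightarrow> (int + complex) list set"
  where "ring_elt \<O> x = free_product_inr (integer_mod_group 2) (additive_group \<O>) x"


section \<open>Finite continued fractions\<close>

text \<open>
  A finite continued fraction has at least one partial quotient. The empty word must be left out:
  both sides of the generating relation are nonempty, so it would be equivalent only to itself,
  and the identity of the group of classes is the class of \<open>[0, 0]\<close>.
\<close>

definition FCF :: "complex set \<Rightarrow> complex list set"
  where "FCF \<O> = {c \<in> lists \<O>. c \<noteq> []}"

inductive_set FCF_rel :: "complex set \<Rightarrow> (complex list \<times> complex list) set"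
  for \<O> :: "complex set"
where
  refl: "c \<in> FCF \<O> \<Longrightarrow> (c, c) \<in> FCF_rel \<O>"
| sym: "(c, d) \<in> FCF_rel \<O> \<Longrightarrow> (d, c) \<in> FCF_rel \<O>"
| trans: "\<lbrakk>(c, d) \<in> FCF_rel \<O>; (d, e) \<in> FCF_rel \<O>\<rbrakk> \<Longrightarrow> (c, e) \<in> FCF_rel \<O>"
| zero: "\<lbrakk>u \<in> lists \<O>; v \<in> lists \<O>; x \<in> \<O>; y \<in> \<O>\<rbrakk>
    \<Longrightarrow> (u @ [x, 0, y] @ v, u @ [x + y] @ v) \<in> FCF_rel \<O>"

definition FCF_bar :: "complex set \<Rightarrow> complex list set monoid"
where
  "FCF_bar \<O> =
     \<lparr>carrier = FCF \<O> // FCF_rel \<O>,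
      monoid.mult = (\<lambda>A B. \<Union>c\<in>A. \<Union>d\<in>B. FCF_rel \<O> `` {c @ d}),
      one = FCF_rel \<O> `` {[0, 0]}\<rparr>"

definition W_F :: "complex set \<Rightarrow> complex list \<Rightarrow> (int + complex) list set"
where
  "W_F \<O> c =
     foldr (\<lambda>x w. ring_elt \<O> x \<otimes>\<^bsub>Z2_free_product \<O>\<^esub> (j_gen \<O> \<otimes>\<^bsub>Z2_free_product \<O>\<^esub> w))
       c \<one>\<^bsub>Z2_free_product \<O>\<^esub>"


section \<open>Periodic continued fractions\<close>

text \<open>
  A periodic continued fraction is the sequence of its partial quotients together with its type
  \<open>(N, k)\<close>. Sequences are indexed from 0, so that \<open>b\<^sub>i\<close> is \<open>s (i - 1)\<close> and
  \<open>a\<^sub>i\<close> is \<open>s (N + i - 1)\<close>.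
\<close>

type_synonym pcf = "(nat \<Rightarrow> complex) \<times> nat \<times> nat"

definition PCF :: "complex set \<Rightarrow> pcf set"
  where "PCF \<O> = {(s, N, k). k \<ge> 1 \<and> (\<forall>i. s i \<in> \<O>) \<and> (\<forall>i\<ge>N. s (i + k) = s i)}"

fun SF :: "pcf \<Rightarrow> complex list"
where
  "SF (s, N, k) =
     (if N > 0 then map s [0..<N + k] @ [0] @ map (\<lambda>i. - s i) (rev [0..<N]) @ [0]
      else map s [0..<k])"

definition SR :: "complex list \<Rightarrow> pcf"
  where "SR c = ((\<lambda>i. c ! (i mod length c)), 0, length c)"

definition W_P :: "complex set \<Rightarrow> pcf \<Rightarrow> (int + complex) list set"
  where "W_P \<O> = W_F \<O> \<circ> SF"

definition PCF_rel :: "complex set \<Rightarrow> (pcf \<times> pcf) set"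
  where "PCF_rel \<O> = {(P, Q). P \<in> PCF \<O> \<and> Q \<in> PCF \<O> \<and> (SF P, SF Q) \<in> FCF_rel \<O>}"

definition PCF_star :: "complex set \<Rightarrow> pcf \<Rightarrow> pcf \<Rightarrow> pcf set"
  where "PCF_star \<O> P Q = PCF_rel \<O> `` {SR (SF P @ SF Q)}"

text \<open>
  The unions over representatives are the usual lifting of a class-valued operation to the
  quotient; they give the intended operation once it is known not to depend on representatives.
  The identity is the class of the repeating continued fraction with repeating block \<open>0, 0\<close>.
\<close>

definition PCF_bar :: "complex set \<Rightarrow> pcf set monoid"
where
  "PCF_bar \<O> =
     \<lparr>carrier = PCF \<O> // PCF_rel \<O>,
      monoid.mult = (\<lambda>A B. \<Union>P\<in>A. \<Union>Q\<in>B. PCF_star \<O> P Q),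
      one = PCF_rel \<O> `` {SR [0, 0]}\<rparr>"

definition W_P_bar :: "complex set \<Rightarrow> pcf set \<Rightarrow> (int + complex) list set"
  where "W_P_bar \<O> A = the_elem (W_P \<O> ` A)"

end

theory Submission
  imports Defs
begin

text \<open>
  Sending a letter \<open>j\<close> to \<open>[0]\<close> and a letter \<open>x\<close> in \<open>\<O>\<close> to \<open>[x, 0]\<close> respects the relations of
  the free product up to \<open>\<sim>\<close>, and it inverts \<open>W\<^sub>F\<close> on classes in both directions. So \<open>\<sim>\<close> is exactly
  the kernel of \<open>W\<^sub>F\<close>, with no need for normal forms in the free product. Since \<open>SF\<close> takes
  values in finite continued fractions and \<open>SF (SR c) = c\<close>, the map \<open>W\<^sub>P\<close> is onto as well, and
  both quotients acquire their group structure from the fibres of a multiplicative surjection.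
\<close>

section \<open>Quotients by the fibres of a map onto a group\<close>

text \<open>The operation \<open>m\<close> need only be multiplicative under \<open>f\<close>: the
  group laws on the quotient are transported from \<open>G\<close> along \<open>fibre\<close>.
  Instances are \<open>W_F\<close> with concatenation and \<open>W_P\<close> with the operation on
  representatives.\<close>

locale fibre_quotient = group G for G (structure) +
  fixes S :: "'x set" and f :: "'x \<Rightarrow> 'a" and m :: "'x \<Rightarrow> 'x \<Rightarrow> 'x" and e :: 'x
    and r :: "('x \<times> 'x) set"
  assumes surj: "f ` S = carrier G"
    and op_closed: "\<lbrakk>x \<in> S; y \<in> S\<rbrakk> \<Longrightarrow> m x y \<in> S"
    and f_op: "\<lbrakk>x \<in> S; y \<in> S\<rbrakk> \<Longrightarrow> f (m x y) = f x \<otimes> f y"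
    and e_closed: "e \<in> S"
    and f_e: "f e = \<one>"
    and r_eq: "r = {(x, y). x \<in> S \<and> y \<in> S \<and> f x = f y}"
begin

text \<open>Shaped exactly like \<open>FCF_bar\<close> and \<open>PCF_bar\<close>, so that
  \<open>quot_eq\<close> needs nothing beyond unfolding.\<close>

definition quot :: "'x set monoid"
  where "quot = \<lparr>carrier = S // r,
    monoid.mult = (\<lambda>A B. \<Union>x\<in>A. \<Union>y\<in>B. r `` {m x y}), one = r `` {e}\<rparr>"

definition fibre :: "'a \<Rightarrow> 'x set"
  where "fibre g = {x \<in> S. f x = g}"

lemma equiv_r: "equiv S r"
  unfolding r_eq by (auto simp: equiv_def refl_on_def sym_def trans_def)

lemma class_eq_fibre: "x \<in> S \<Longrightarrow> r `` {x} = fibre (f x)"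
  by (auto simp: r_eq fibre_def)

lemma respects2: "(\<lambda>x y. r `` {m x y}) respects2 r"
  by (rule congruent2I') (auto simp: r_eq op_closed f_op)

lemma respects: "f respects r"
  by (auto simp: congruent_def r_eq)

lemma fibre_nonempty: "g \<in> carrier G \<Longrightarrow> \<exists>x\<in>S. f x = g"
  unfolding surj [symmetric] by blast

lemma carrier_quot: "carrier quot = fibre ` carrier G"
proof -
  have "S // r = (\<lambda>x. fibre (f x)) ` S"
    unfolding quotient_def using class_eq_fibre by auto
  then show ?thesis
    by (simp add: quot_def surj [symmetric] image_image)
qed

text \<open>By \<open>respects2\<close> the union over all representatives collapses to a single
  class, and \<open>f_op\<close> says which fibre that class is.\<close>

lemma mult_quot:
  assumes "g \<in> carrier G" "h \<in> carrier G"
  shows "fibre g \<otimes>\<^bsub>quot\<^esub> fibre h = fibre (g \<otimes> h)"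
proof -
  obtain x y where xy: "x \<in> S" "f x = g" "y \<in> S" "f y = h"
    using assms fibre_nonempty by meson
  \<comment> \<open>The index sets refer to the chosen representatives \<open>x\<close> and
    \<open>y\<close>; in the body the same names are bound.\<close>
  have "fibre g \<otimes>\<^bsub>quot\<^esub> fibre h = (\<Union>x\<in>r `` {x}. \<Union>y\<in>r `` {y}. r `` {m x y})"
    using xy by (simp add: quot_def class_eq_fibre)
  also have "\<dots> = r `` {m x y}"
    using UN_equiv_class2 [OF equiv_r equiv_r respects2] xy by blast
  finally show ?thesis
    using xy by (simp add: class_eq_fibre op_closed f_op)
qed

lemma the_elem_fibre:
  assumes "g \<in> carrier G"
  shows "the_elem (f ` fibre g) = g"
proof -
  have "f ` fibre g = {g}"
    using fibre_nonempty [OF assms] by (auto simp: fibre_def)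
  then show ?thesis by simp
qed

lemma the_elem_class: "x \<in> S \<Longrightarrow> the_elem (f ` (r `` {x})) = f x"
  using the_elem_fibre surj class_eq_fibre by auto

lemma fibre_iso: "fibre \<in> iso G quot"
proof (rule isoI)
  show "fibre \<in> hom G quot"
    by (auto simp: hom_def carrier_quot mult_quot)
  have "inj_on fibre (carrier G)"
    by (metis inj_onI the_elem_fibre)
  then show "bij_betw fibre (carrier G) (carrier quot)"
    by (simp add: bij_betw_def carrier_quot)
qed

lemma group_quot: "group quot"
proof -
  \<comment> \<open>Transport along \<open>fibre\<close> gives a group whose unit is set to
    \<open>fibre \<one>\<close>; that record is \<open>quot\<close> itself.\<close>
  have "one quot = fibre \<one>"
    by (simp add: quot_def class_eq_fibre e_closed f_e)
  then have "quot\<lparr>one := fibre \<one>\<rparr> = quot"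
    by (simp add: quot_def)
  then show ?thesis
    using iso_imp_img_group [OF fibre_iso] by metis
qed

lemma the_elem_iso: "(\<lambda>A. the_elem (f ` A)) \<in> iso quot G"
proof (rule isoI)
  show "(\<lambda>A. the_elem (f ` A)) \<in> hom quot G"
    by (auto simp: hom_def carrier_quot mult_quot the_elem_fibre)
  show "bij_betw (\<lambda>A. the_elem (f ` A)) (carrier quot) (carrier G)"
    by (rule bij_betw_byWitness [where f' = fibre]) (auto simp: carrier_quot the_elem_fibre)
qed

end


section \<open>The free product is a group\<close>

locale free_product_groups = G: group G + H: group H
  for G :: "('a, 'm) monoid_scheme" and H :: "('b, 'n) monoid_scheme"
begin

abbreviation "W \<equiv> lists (carrier G <+> carrier H)"
abbreviation "R \<equiv> free_product_rel G H"
abbreviation cls :: "('a + 'b) list \<Rightarrow> ('a + 'b) list set" where "cls w \<equiv> R `` {w}"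

declare InlI [simp] InrI [simp]

lemma rel_in_words: "(v, w) \<in> R \<Longrightarrow> v \<in> W \<and> w \<in> W"
  by (induction rule: free_product_rel.induct) auto

lemma equiv_rel: "equiv W R"
  using rel_in_words
  by (auto simp: equiv_def refl_on_def sym_def trans_def
      intro: free_product_rel.refl free_product_rel.sym free_product_rel.trans)

text \<open>Every generating relation already carries an arbitrary context \<open>u\<close>,
  \<open>v\<close>, so a larger context gives another instance of the same relation.\<close>

lemma rel_append_both:
  assumes "(v, w) \<in> R" "a \<in> W" "b \<in> W"
  shows "(a @ v @ b, a @ w @ b) \<in> R"
  using assms
proof (induction rule: free_product_rel.induct)
  case (refl w)
  then show ?case by (auto intro!: free_product_rel.refl)
next
  case (sym v w)
  then show ?case by (blast intro: free_product_rel.sym)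
next
  case (trans u v w)
  then show ?case by (blast intro: free_product_rel.trans)
next
  case (mult_left u v x y)
  then show ?case using free_product_rel.mult_left [of "a @ u" G H "v @ b" x y] by simp
next
  case (mult_right u v x y)
  then show ?case using free_product_rel.mult_right [of "a @ u" G H "v @ b" x y] by simp
next
  case (one_left u v)
  then show ?case using free_product_rel.one_left [of "a @ u" G H "v @ b"] by simp
next
  case (one_right u v)
  then show ?case using free_product_rel.one_right [of "a @ u" G H "v @ b"] by simp
qed

lemma rel_append:
  assumes "(v, w) \<in> R" "(v', w') \<in> R"
  shows "(v @ v', w @ w') \<in> R"
proof -
  \<comment> \<open>One factor is changed at a time, the other being kept as context.\<close>
  have "([] @ v @ v', [] @ w @ v') \<in> R" "(w @ v' @ [], w @ w' @ []) \<in> R"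
    using assms rel_in_words by (blast intro: rel_append_both lists.Nil)+
  then show ?thesis
    by (auto intro: free_product_rel.trans)
qed

lemma cls_eq_iff: "\<lbrakk>v \<in> W; w \<in> W\<rbrakk> \<Longrightarrow> cls v = cls w \<longleftrightarrow> (v, w) \<in> R"
  using eq_equiv_class_iff [OF equiv_rel] by blast

lemma mult_cls:
  assumes "v \<in> W" "w \<in> W"
  shows "cls v \<otimes>\<^bsub>free_product G H\<^esub> cls w = cls (v @ w)"
proof -
  have "(\<lambda>u v. cls (u @ v)) respects2 R"
  proof (rule congruent2I')
    fix v w v' w' assume "(v, w) \<in> R" "(v', w') \<in> R"
    then show "cls (v @ v') = cls (w @ w')"
      by (rule equiv_class_eq [OF equiv_rel rel_append])
  qed
  from UN_equiv_class2 [OF equiv_rel equiv_rel this assms] show ?thesis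
    by (simp add: free_product_def)
qed

lemma one_free_product: "\<one>\<^bsub>free_product G H\<^esub> = cls []"
  by (simp add: free_product_def)

lemma carrier_free_product: "carrier (free_product G H) = cls ` W"
  by (auto simp: free_product_def quotient_def)

lemma letter_left_inv:
  assumes "a \<in> carrier G <+> carrier H"
  shows "\<exists>b \<in> carrier G <+> carrier H. ([b, a], []) \<in> R"
proof (cases a)
  case (Inl x)
  then have x: "x \<in> carrier G" using assms by auto
  have "([Inl (inv\<^bsub>G\<^esub> x), Inl x], [Inl \<one>\<^bsub>G\<^esub>]) \<in> R"
    using free_product_rel.mult_left [of "[]" G H "[]" "inv\<^bsub>G\<^esub> x" x] x by simp
  moreover have "([Inl \<one>\<^bsub>G\<^esub>], []) \<in> R"
    using free_product_rel.one_left [of "[]" G H "[]"] by simp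
  ultimately have "([Inl (inv\<^bsub>G\<^esub> x), Inl x], []) \<in> R"
    by (rule free_product_rel.trans)
  then show ?thesis using Inl x by blast
next
  case (Inr x)
  then have x: "x \<in> carrier H" using assms by auto
  have "([Inr (inv\<^bsub>H\<^esub> x), Inr x], [Inr \<one>\<^bsub>H\<^esub>]) \<in> R"
    using free_product_rel.mult_right [of "[]" G H "[]" "inv\<^bsub>H\<^esub> x" x] x by simp
  moreover have "([Inr \<one>\<^bsub>H\<^esub>], []) \<in> R"
    using free_product_rel.one_right [of "[]" G H "[]"] by simp
  ultimately have "([Inr (inv\<^bsub>H\<^esub> x), Inr x], []) \<in> R"
    by (rule free_product_rel.trans)
  then show ?thesis using Inr x by blast
qed

text \<open>Inverse letters in reversed order cancel from the inside outwards. Left inverses are all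
  that \<open>groupI\<close> asks for.\<close>

lemma word_left_inv: "w \<in> W \<Longrightarrow> \<exists>v\<in>W. (v @ w, []) \<in> R"
proof (induction w)
  case Nil
  then show ?case using free_product_rel.refl [of "[]" G H] by fastforce
next
  case (Cons a w)
  then obtain v b where v: "v \<in> W" "(v @ w, []) \<in> R"
    and b: "b \<in> carrier G <+> carrier H" "([b, a], []) \<in> R"
    using letter_left_inv by (metis listsE)
  have "(v @ [b, a] @ w, v @ [] @ w) \<in> R"
    using b v Cons.prems by (intro rel_append_both) auto
  then have "((v @ [b]) @ a # w, []) \<in> R"
    using v(2) by (auto intro: free_product_rel.trans)
  moreover have "v @ [b] \<in> W" using v b by auto
  ultimately show ?case by blast
qed

lemma group_free_product: "group (free_product G H)"
proof (rule groupI)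
  fix A assume "A \<in> carrier (free_product G H)"
  then obtain w where w: "w \<in> W" "A = cls w"
    by (auto simp: carrier_free_product)
  then obtain v where v: "v \<in> W" "(v @ w, []) \<in> R"
    using word_left_inv by blast
  have "cls v \<otimes>\<^bsub>free_product G H\<^esub> A = \<one>\<^bsub>free_product G H\<^esub>"
    using v w equiv_class_eq [OF equiv_rel v(2)] by (simp add: mult_cls one_free_product)
  then show "\<exists>B\<in>carrier (free_product G H). B \<otimes>\<^bsub>free_product G H\<^esub> A = \<one>\<^bsub>free_product G H\<^esub>"
    using v by (auto simp: carrier_free_product)
next
  show "\<one>\<^bsub>free_product G H\<^esub> \<in> carrier (free_product G H)"
    by (simp add: one_free_product carrier_free_product)
next
  fix A B assume "A \<in> carrier (free_product G H)" "B \<in> carrier (free_product G H)"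
  then obtain v w where "v \<in> W" "w \<in> W" "A = cls v" "B = cls w"
    by (auto simp only: carrier_free_product)
  then show "A \<otimes>\<^bsub>free_product G H\<^esub> B \<in> carrier (free_product G H)"
    by (simp add: mult_cls carrier_free_product)
next
  fix A B C
  assume "A \<in> carrier (free_product G H)" "B \<in> carrier (free_product G H)"
    "C \<in> carrier (free_product G H)"
  then obtain u v w where "u \<in> W" "v \<in> W" "w \<in> W" "A = cls u" "B = cls v" "C = cls w"
    by (auto simp only: carrier_free_product)
  then show "A \<otimes>\<^bsub>free_product G H\<^esub> B \<otimes>\<^bsub>free_product G H\<^esub> C =
      A \<otimes>\<^bsub>free_product G H\<^esub> (B \<otimes>\<^bsub>free_product G H\<^esub> C)"
    by (simp add: mult_cls)
next
  fix A assume "A \<in> carrier (free_product G H)"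
  then obtain w where "w \<in> W" "A = cls w"
    by (auto simp only: carrier_free_product)
  then show "\<one>\<^bsub>free_product G H\<^esub> \<otimes>\<^bsub>free_product G H\<^esub> A = A"
    by (simp add: mult_cls one_free_product)
qed

end


section \<open>The relation on finite continued fractions is the kernel of \<open>W\<^sub>F\<close>\<close>

text \<open>In the free product \<open>[0]\<close> evaluates to j, and \<open>[x, 0]\<close> to x j
  0 j = x. The identity letter \<open>Inl 0\<close> goes to \<open>[0, 0]\<close> and not to the
  empty list, because \<open>FCF_rel\<close> relates nonempty words only.\<close>

fun letter_fcf :: "int + complex \<Rightarrow> complex list"
where
  "letter_fcf (Inl k) = (if k = 0 then [0, 0] else [0])"
| "letter_fcf (Inr x) = [x, 0]"

text \<open>
  The trailing \<open>[0, 0]\<close>, which represents the identity, keeps the image of the empty word nonempty.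
\<close>

definition word_fcf :: "(int + complex) list \<Rightarrow> complex list"
  where "word_fcf w = concat (map letter_fcf w) @ [0, 0]"

text \<open>The unreduced word x1 j x2 j ... xn j, whose class is \<open>W_F\<close>.\<close>

definition fcf_word :: "complex list \<Rightarrow> (int + complex) list"
  where "fcf_word c = concat (map (\<lambda>x. [Inr x, Inl 1]) c)"

section \<open>The coefficient ring and the relation on finite continued fractions\<close>

locale complex_subring =
  fixes \<O> :: "complex set"
  assumes subring: "subring \<O> complex_ring"
begin

lemma ring_O: "ring (complex_ring\<lparr>carrier := \<O>\<rparr>)"
  using ring.subring_is_ring [OF ring_from_type_algebra subring] .

lemma zero_in: "0 \<in> \<O>"
  using subringE(2) [OF subring] by (simp add: ring_of_type_algebra_def)

lemma add_in: "\<lbrakk>x \<in> \<O>; y \<in> \<O>\<rbrakk> \<Longrightarrow> x + y \<in> \<O>"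
  using subringE(7) [OF subring, of x y] by (simp add: ring_of_type_algebra_def)

lemma uminus_in:
  assumes "x \<in> \<O>"
  shows "- x \<in> \<O>"
proof -
  interpret ring "complex_ring\<lparr>carrier := \<O>\<rparr>" by (rule ring_O)
  have "\<exists>y\<in>\<O>. y + x = 0"
    using add.l_inv_ex [of x] assms by (simp add: ring_of_type_algebra_def)
  then show ?thesis
    by (metis eq_neg_iff_add_eq_0)
qed

text \<open>An opaque name for the additive group, with its own simplification rules; it is unfolded
  again only in the final theorem.\<close>

definition add_O :: "complex monoid"
  where "add_O = additive_group \<O>"

lemma add_O_simps [simp]:
  "carrier add_O = \<O>" "x \<otimes>\<^bsub>add_O\<^esub> y = x + y" "\<one>\<^bsub>add_O\<^esub> = 0"
  by (simp_all add: add_O_def ring_of_type_algebra_def)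

sublocale fp: free_product_groups "integer_mod_group 2" add_O
  unfolding free_product_groups_def add_O_def
  using abelian_group.a_group [OF ring.is_abelian_group [OF ring_O]] by simp

lemma FCF_rel_in_FCF: "(c, d) \<in> FCF_rel \<O> \<Longrightarrow> c \<in> FCF \<O> \<and> d \<in> FCF \<O>"
  by (induction rule: FCF_rel.induct) (auto simp: FCF_def zero_in add_in)

lemma FCF_rel_append_both:
  assumes "(c, d) \<in> FCF_rel \<O>" "a \<in> lists \<O>" "b \<in> lists \<O>"
  shows "(a @ c @ b, a @ d @ b) \<in> FCF_rel \<O>"
  using assms
proof (induction rule: FCF_rel.induct)
  case (refl c)
  then show ?case by (auto simp: FCF_def intro!: FCF_rel.refl)
next
  case (sym c d)
  then show ?case by (blast intro: FCF_rel.sym)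
next
  case (trans c d e)
  then show ?case by (blast intro: FCF_rel.trans)
next
  case (zero u v x y)
  then show ?case using FCF_rel.zero [of "a @ u" \<O> "v @ b" x y] by simp
qed

text \<open>A pair of zeros is absorbed by a neighbour: \<open>[0, 0, y]\<close> becomes
  \<open>[0 + y]\<close> and \<open>[x, 0, 0]\<close> becomes \<open>[x + 0]\<close>. Nonemptiness
  of \<open>u @ v\<close> guarantees that a neighbour exists.\<close>

lemma FCF_rel_zero_zero:
  assumes "u \<in> lists \<O>" "v \<in> lists \<O>" "u @ v \<noteq> []"
  shows "(u @ [0, 0] @ v, u @ v) \<in> FCF_rel \<O>"
proof (cases v)
  case (Cons y v')
  then show ?thesis
    using FCF_rel.zero [of u \<O> v' 0 y] assms zero_in by simp
next
  case Nil
  then obtain u' x where "u = u' @ [x]"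
    using assms by (metis append_Nil2 rev_exhaust)
  then show ?thesis
    using FCF_rel.zero [of u' \<O> "[]" x 0] assms zero_in Nil by simp
qed

section \<open>From words in the free product to continued fractions\<close>

lemma word_fcf_in_FCF: "w \<in> fp.W \<Longrightarrow> word_fcf w \<in> FCF \<O>"
proof (induction w)
  case (Cons a w)
  then show ?case by (cases a) (auto simp: word_fcf_def FCF_def zero_in)
qed (auto simp: word_fcf_def FCF_def zero_in)

lemma letters_in: "w \<in> fp.W \<Longrightarrow> concat (map letter_fcf w) \<in> lists \<O>"
  using word_fcf_in_FCF by (auto simp: word_fcf_def FCF_def)

lemma word_fcf_replace:
  assumes "u \<in> fp.W" "v \<in> fp.W"
    and "(concat (map letter_fcf s), concat (map letter_fcf t)) \<in> FCF_rel \<O>"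
  shows "(word_fcf (u @ s @ v), word_fcf (u @ t @ v)) \<in> FCF_rel \<O>"
  using FCF_rel_append_both [OF assms(3) letters_in [OF assms(1)],
      of "concat (map letter_fcf v) @ [0, 0]"] letters_in [OF assms(2)] zero_in
  by (simp add: word_fcf_def)

text \<open>Serves the two relations that delete an identity letter, both \<open>Inl 0\<close> and
  \<open>Inr 0\<close> being sent to \<open>[0, 0]\<close>. The trailing \<open>[0, 0]\<close> of
  \<open>word_fcf\<close> supplies the neighbour that absorbs the pair.\<close>

lemma word_fcf_insert:
  assumes "u \<in> fp.W" "v \<in> fp.W" and s: "concat (map letter_fcf s) = [0, 0]"
  shows "(word_fcf (u @ s @ v), word_fcf (u @ v)) \<in> FCF_rel \<O>"
  using FCF_rel_zero_zero [OF letters_in [OF assms(1)],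
      of "concat (map letter_fcf v) @ [0, 0]"] letters_in [OF assms(2)] zero_in s
  by (simp add: word_fcf_def)

text \<open>This makes the inverse of \<open>W_F\<close> well defined on classes. The product of two
  ring letters is the generating relation itself, \<open>[x, 0, y, 0]\<close> against
  \<open>[x + y, 0]\<close>; the other relations come down to absorbing pairs of zeros.\<close>

lemma word_fcf_rel: "(v, w) \<in> fp.R \<Longrightarrow> (word_fcf v, word_fcf w) \<in> FCF_rel \<O>"
proof (induction rule: free_product_rel.induct)
  case (refl w)
  then show ?case
    using word_fcf_in_FCF by (simp add: FCF_rel.refl)
next
  case (sym v w)
  then show ?case by (blast intro: FCF_rel.sym)
next
  case (trans u v w)
  then show ?case by (blast intro: FCF_rel.trans)
next
  case (mult_left u v x y)
  have "x \<in> {0, 1}" "y \<in> {0, 1}"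
    using mult_left by (auto simp: carrier_integer_mod_group)
  \<comment> \<open>In order: both letters trivial, exactly one equal to j, and both equal to j,
    where the product 1 + 1 is 0 modulo 2.\<close>
  moreover have "([0, 0, 0, 0], [0, 0]) \<in> FCF_rel \<O>" "([0, 0, 0], [0]) \<in> FCF_rel \<O>"
    "([0, 0], [0, 0]) \<in> FCF_rel \<O>"
    using FCF_rel_zero_zero [of "[]" "[0, 0]"] FCF_rel_zero_zero [of "[]" "[0]"] zero_in
    by (auto intro: FCF_rel.refl simp: FCF_def)
  ultimately have "(concat (map letter_fcf [Inl x, Inl y]),
      concat (map letter_fcf [Inl (x \<otimes>\<^bsub>integer_mod_group 2\<^esub> y)])) \<in> FCF_rel \<O>"
    by auto
  then show ?case
    using mult_left by (intro word_fcf_replace) auto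
next
  case (mult_right u v x y)
  then have "x \<in> \<O>" "y \<in> \<O>"
    by auto
  then have "(concat (map letter_fcf [Inr x, Inr y]),
      concat (map letter_fcf [Inr (x \<otimes>\<^bsub>add_O\<^esub> y)])) \<in> FCF_rel \<O>"
    using FCF_rel.zero [of "[]" \<O> "[0]" x y] zero_in by simp
  then show ?case
    using mult_right by (intro word_fcf_replace) auto
next
  case (one_left u v)
  then show ?case
    by (intro word_fcf_insert) auto
next
  case (one_right u v)
  then show ?case
    by (intro word_fcf_insert) auto
qed

section \<open>From continued fractions to words in the free product\<close>

lemma fcf_word_in: "c \<in> lists \<O> \<Longrightarrow> fcf_word c \<in> fp.W"
  by (induction c) (auto simp: fcf_word_def)

lemma W_F_conv_add_O:
  "W_F \<O> c = foldr (\<lambda>x w. fp.cls [Inr x] \<otimes>\<^bsub>free_product (integer_mod_group 2) add_O\<^esub>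
    (fp.cls [Inl 1] \<otimes>\<^bsub>free_product (integer_mod_group 2) add_O\<^esub> w))
    c \<one>\<^bsub>free_product (integer_mod_group 2) add_O\<^esub>"
  unfolding W_F_def ring_elt_def free_product_inr_def j_gen_def free_product_inl_def
    add_O_def ..

lemma W_F_eq: "c \<in> lists \<O> \<Longrightarrow> W_F \<O> c = fp.cls (fcf_word c)"
proof (induction c)
  case Nil
  then show ?case by (simp add: W_F_conv_add_O fcf_word_def fp.one_free_product)
next
  case (Cons x c)
  then have "W_F \<O> (x # c) = fp.cls [Inr x] \<otimes>\<^bsub>free_product (integer_mod_group 2) add_O\<^esub>
      (fp.cls [Inl 1] \<otimes>\<^bsub>free_product (integer_mod_group 2) add_O\<^esub> fp.cls (fcf_word c))"
    by (simp add: W_F_conv_add_O)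
  also have "\<dots> = fp.cls (fcf_word (x # c))"
    using Cons.prems fcf_word_in [of c] by (simp add: fp.mult_cls fcf_word_def)
  finally show ?case .
qed

lemma W_F_append:
  assumes "c \<in> lists \<O>" "d \<in> lists \<O>"
  shows "W_F \<O> (c @ d) = W_F \<O> c \<otimes>\<^bsub>free_product (integer_mod_group 2) add_O\<^esub> W_F \<O> d"
  using assms fcf_word_in by (simp add: W_F_eq fp.mult_cls fcf_word_def)

text \<open>The computation is x j 0 j y j = x j j y j = x y j = (x + y) j, with the trivial letter
  from j j deleted on the way.\<close>

lemma fcf_word_zero:
  assumes "x \<in> \<O>" "y \<in> \<O>"
  shows "(fcf_word [x, 0, y], fcf_word [x + y]) \<in> fp.R"
proof -
  note free_product_rel.trans [trans]
  have "(fcf_word [x, 0, y], [Inr x, Inl 1, Inl 1, Inr y, Inl 1]) \<in> fp.R"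
    using free_product_rel.one_right [of "[Inr x, Inl 1]" "integer_mod_group 2" add_O
        "[Inl 1, Inr y, Inl 1]"] assms by (simp add: fcf_word_def)
  also have "([Inr x, Inl 1, Inl 1, Inr y, Inl 1], [Inr x, Inl 0, Inr y, Inl 1]) \<in> fp.R"
    using free_product_rel.mult_left [of "[Inr x]" "integer_mod_group 2" add_O
        "[Inr y, Inl 1]" 1 1] assms by simp
  also have "([Inr x, Inl 0, Inr y, Inl 1], [Inr x, Inr y, Inl 1]) \<in> fp.R"
    using free_product_rel.one_left [of "[Inr x]" "integer_mod_group 2" add_O
        "[Inr y, Inl 1]"] assms by simp
  also have "([Inr x, Inr y, Inl 1], fcf_word [x + y]) \<in> fp.R"
    using free_product_rel.mult_right [of "[]" "integer_mod_group 2" add_O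
        "[Inl 1]" x y] assms by (simp add: fcf_word_def)
  finally show ?thesis .
qed

lemma fcf_word_rel: "(c, d) \<in> FCF_rel \<O> \<Longrightarrow> (fcf_word c, fcf_word d) \<in> fp.R"
proof (induction rule: FCF_rel.induct)
  case (refl c)
  then show ?case
    by (intro free_product_rel.refl fcf_word_in) (simp add: FCF_def)
next
  case (sym c d)
  then show ?case by (blast intro: free_product_rel.sym)
next
  case (trans c d e)
  then show ?case by (blast intro: free_product_rel.trans)
next
  case (zero u v x y)
  then have "(fcf_word u @ fcf_word [x, 0, y] @ fcf_word v,
      fcf_word u @ fcf_word [x + y] @ fcf_word v) \<in> fp.R"
    by (intro fp.rel_append_both fcf_word_zero fcf_word_in)
  then show ?case by (simp add: fcf_word_def)
qed

section \<open>The two round trips\<close>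

lemma word_fcf_fcf_word:
  assumes "c \<in> FCF \<O>"
  shows "(word_fcf (fcf_word c), c) \<in> FCF_rel \<O>"
proof -
  \<comment> \<open>Each entry x yields the letters x and j, hence \<open>[x, 0]\<close> followed by
    \<open>[0]\<close>. The round trip therefore inserts \<open>[0, 0]\<close> after every entry and
    once more at the end.\<close>
  define expand where "expand = (\<lambda>c :: complex list. concat (map (\<lambda>x. [x, 0, 0]) c))"
  \<comment> \<open>The prefix \<open>c1\<close> collects the entries already cleared of their
    zeros; with \<open>x\<close> appended it is nonempty and can absorb the next pair.\<close>
  have "(c1 @ expand c2, c1 @ c2) \<in> FCF_rel \<O>"
    if "c1 \<in> lists \<O>" "c2 \<in> lists \<O>" "c1 @ c2 \<noteq> []" for c1 c2
    using that
  proof (induction c2 arbitrary: c1)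
    case Nil
    then show ?case by (auto simp: expand_def FCF_def intro!: FCF_rel.refl)
  next
    case (Cons x c2)
    have "expand c2 \<in> lists \<O>"
      using Cons.prems zero_in by (auto simp: expand_def)
    then have "((c1 @ [x]) @ [0, 0] @ expand c2, (c1 @ [x]) @ expand c2) \<in> FCF_rel \<O>"
      using Cons.prems by (intro FCF_rel_zero_zero) auto
    moreover have "((c1 @ [x]) @ expand c2, (c1 @ [x]) @ c2) \<in> FCF_rel \<O>"
      using Cons.prems by (intro Cons.IH) auto
    ultimately show ?case
      by (auto simp: expand_def intro: FCF_rel.trans)
  qed
  from this [of "[]" c] have 1: "(expand c, c) \<in> FCF_rel \<O>"
    using assms by (simp add: FCF_def)
  have "expand c \<in> FCF \<O>"
    using FCF_rel_in_FCF [OF 1] ..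
  then have "(expand c @ [0, 0], expand c) \<in> FCF_rel \<O>"
    using FCF_rel_zero_zero [of "expand c" "[]"] by (simp add: FCF_def)
  moreover have "word_fcf (fcf_word c) = expand c @ [0, 0]"
    by (induction c) (simp_all add: word_fcf_def fcf_word_def expand_def)
  ultimately show ?thesis
    using 1 by (metis FCF_rel.trans)
qed

lemma fcf_word_letter_fcf:
  assumes "a \<in> carrier (integer_mod_group 2) <+> \<O>"
  shows "(fcf_word (letter_fcf a), [a]) \<in> fp.R"
proof -
  \<comment> \<open>This is x j 0 j = x. It settles every ring letter, and at x = 0 also the
    identity letter \<open>Inl 0\<close>, whose image is \<open>[0, 0]\<close>.\<close>
  have drop: "([Inr x, Inl 1, Inr 0, Inl 1], [Inr x]) \<in> fp.R" if "x \<in> \<O>" for x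
  proof -
    note free_product_rel.trans [trans]
    have "([Inr x, Inl 1, Inr 0, Inl 1], [Inr x, Inl 1, Inl 1]) \<in> fp.R"
      using free_product_rel.one_right [of "[Inr x, Inl 1]" "integer_mod_group 2" add_O "[Inl 1]"]
        that by simp
    also have "([Inr x, Inl 1, Inl 1], [Inr x, Inl 0]) \<in> fp.R"
      using free_product_rel.mult_left [of "[Inr x]" "integer_mod_group 2" add_O "[]" 1 1]
        that by simp
    also have "([Inr x, Inl 0], [Inr x]) \<in> fp.R"
      using free_product_rel.one_left [of "[Inr x]" "integer_mod_group 2" add_O "[]"]
        that by simp
    finally show ?thesis .
  qed
  have "([Inr 0], []) \<in> fp.R" "([Inl 0], []) \<in> fp.R" "([Inr 0, Inl 1], [Inl 1]) \<in> fp.R"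
    using free_product_rel.one_right [of "[]" "integer_mod_group 2" add_O "[]"]
      free_product_rel.one_left [of "[]" "integer_mod_group 2" add_O "[]"]
      free_product_rel.one_right [of "[]" "integer_mod_group 2" add_O "[Inl 1]"] by simp_all
  then have "([Inr 0, Inl 1, Inr 0, Inl 1], [Inl 0]) \<in> fp.R" "([Inr 0, Inl 1], [Inl 1]) \<in> fp.R"
    using drop [OF zero_in] by (blast intro: free_product_rel.sym free_product_rel.trans)+
  moreover have "k = 0 \<or> k = 1" if "a = Inl k" for k
    using that assms by (auto simp: carrier_integer_mod_group)
  ultimately show ?thesis
    using drop assms by (cases a) (auto simp: fcf_word_def)
qed

lemma fcf_word_word_fcf: "w \<in> fp.W \<Longrightarrow> (fcf_word (word_fcf w), w) \<in> fp.R"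
proof (induction w)
  case Nil
  \<comment> \<open>The trailing \<open>[0, 0]\<close> is the image of the letter
    \<open>Inl 0\<close>, so the result for single letters covers it.\<close>
  have "(fcf_word (letter_fcf (Inl 0)), [Inl 0]) \<in> fp.R"
    by (rule fcf_word_letter_fcf) simp
  moreover have "([Inl 0], []) \<in> fp.R"
    using free_product_rel.one_left [of "[]" "integer_mod_group 2" add_O "[]"] by simp
  ultimately show ?case
    by (auto simp: word_fcf_def intro: free_product_rel.trans)
next
  case (Cons a w)
  then have "(fcf_word (letter_fcf a) @ fcf_word (word_fcf w), [a] @ w) \<in> fp.R"
    by (intro fp.rel_append fcf_word_letter_fcf) auto
  then show ?case by (simp add: word_fcf_def fcf_word_def)
qed

section \<open>Kernel and image of \<open>W_F\<close>\<close>

lemma FCF_rel_iff_W_F: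
  assumes "c \<in> FCF \<O>" "d \<in> FCF \<O>"
  shows "(c, d) \<in> FCF_rel \<O> \<longleftrightarrow> W_F \<O> c = W_F \<O> d"
proof -
  have cd: "c \<in> lists \<O>" "d \<in> lists \<O>"
    using assms by (auto simp: FCF_def)
  \<comment> \<open>The relation between the words is carried back by \<open>word_fcf\<close>, and
    the round trip is undone at both ends.\<close>
  have "(c, d) \<in> FCF_rel \<O>" if "(fcf_word c, fcf_word d) \<in> fp.R"
    using word_fcf_rel [OF that] word_fcf_fcf_word [OF assms(1)] word_fcf_fcf_word [OF assms(2)]
    by (blast intro: FCF_rel.sym FCF_rel.trans)
  then have "(c, d) \<in> FCF_rel \<O> \<longleftrightarrow> (fcf_word c, fcf_word d) \<in> fp.R"
    using fcf_word_rel by blast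
  then show ?thesis
    using cd by (simp only: W_F_eq fp.cls_eq_iff fcf_word_in)
qed

lemma W_F_surj: "W_F \<O> ` FCF \<O> = carrier (free_product (integer_mod_group 2) add_O)"
proof (intro equalityI subsetI)
  fix A assume "A \<in> W_F \<O> ` FCF \<O>"
  then obtain c where "c \<in> lists \<O>" "A = W_F \<O> c"
    by (auto simp: FCF_def)
  then show "A \<in> carrier (free_product (integer_mod_group 2) add_O)"
    using fcf_word_in by (auto simp only: W_F_eq fp.carrier_free_product add_O_simps)
next
  fix A assume "A \<in> carrier (free_product (integer_mod_group 2) add_O)"
  then obtain w where w: "w \<in> fp.W" "A = fp.cls w"
    by (auto simp only: fp.carrier_free_product)
  then have c: "word_fcf w \<in> FCF \<O>"
    using word_fcf_in_FCF by blast
  then have "W_F \<O> (word_fcf w) = fp.cls (fcf_word (word_fcf w))"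
    by (intro W_F_eq) (simp add: FCF_def)
  also have "\<dots> = A"
    using equiv_class_eq [OF fp.equiv_rel fcf_word_word_fcf] w by blast
  finally show "A \<in> W_F \<O> ` FCF \<O>"
    using c by blast
qed

lemma FCF_append: "\<lbrakk>c \<in> FCF \<O>; d \<in> FCF \<O>\<rbrakk> \<Longrightarrow> c @ d \<in> FCF \<O>"
  by (simp add: FCF_def)

lemma W_F_zero_zero: "W_F \<O> [0, 0] = \<one>\<^bsub>free_product (integer_mod_group 2) add_O\<^esub>"
proof -
  \<comment> \<open>\<open>word_fcf []\<close> is \<open>[0, 0]\<close>.\<close>
  have "(fcf_word (word_fcf []), []) \<in> fp.R"
    by (rule fcf_word_word_fcf) simp
  then show ?thesis
    using equiv_class_eq [OF fp.equiv_rel] zero_in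
    by (simp add: W_F_eq fp.one_free_product word_fcf_def)
qed

sublocale F: fibre_quotient "free_product (integer_mod_group 2) add_O" "FCF \<O>" "W_F \<O>"
  "(@)" "[0, 0]" "FCF_rel \<O>"
proof (intro fibre_quotient.intro fibre_quotient_axioms.intro)
  show "FCF_rel \<O> = {(c, d). c \<in> FCF \<O> \<and> d \<in> FCF \<O> \<and> W_F \<O> c = W_F \<O> d}"
    using FCF_rel_in_FCF FCF_rel_iff_W_F by blast
  show "[0, 0] \<in> FCF \<O>"
    by (simp add: FCF_def zero_in)
  fix c d assume "c \<in> FCF \<O>" "d \<in> FCF \<O>"
  then show "W_F \<O> (c @ d) = W_F \<O> c \<otimes>\<^bsub>free_product (integer_mod_group 2) add_O\<^esub> W_F \<O> d"
    by (intro W_F_append) (simp_all add: FCF_def)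
qed (rule fp.group_free_product W_F_surj FCF_append W_F_zero_zero; assumption)+


section \<open>Periodic continued fractions\<close>

lemma SF_in_FCF: "P \<in> PCF \<O> \<Longrightarrow> SF P \<in> FCF \<O>"
  by (cases P) (auto simp: PCF_def FCF_def zero_in uminus_in)

text \<open>\<open>SR c\<close> has no preperiod, so \<open>SF\<close> reads back exactly one
  period. Surjectivity and multiplicativity pass from \<open>W_F\<close> to \<open>W_P\<close>
  through this identity.\<close>

lemma SF_SR: "c \<noteq> [] \<Longrightarrow> SF (SR c) = c"
  by (auto simp: SR_def intro: nth_equalityI)

lemma SR_in_PCF: "c \<in> FCF \<O> \<Longrightarrow> SR c \<in> PCF \<O>"
  by (auto simp: SR_def PCF_def FCF_def Suc_le_eq)

lemma SR_append_in_PCF: "\<lbrakk>P \<in> PCF \<O>; Q \<in> PCF \<O>\<rbrakk> \<Longrightarrow> SR (SF P @ SF Q) \<in> PCF \<O>"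
  by (intro SR_in_PCF FCF_append SF_in_FCF)

lemma W_P_SR: "c \<in> FCF \<O> \<Longrightarrow> W_P \<O> (SR c) = W_F \<O> c"
  by (simp add: W_P_def SF_SR FCF_def)

lemma W_P_surj: "W_P \<O> ` PCF \<O> = carrier (free_product (integer_mod_group 2) add_O)"
proof -
  have "W_P \<O> ` PCF \<O> = W_F \<O> ` FCF \<O>"
  proof (intro equalityI subsetI)
    fix A assume "A \<in> W_P \<O> ` PCF \<O>"
    then show "A \<in> W_F \<O> ` FCF \<O>"
      using SF_in_FCF by (auto simp: W_P_def simp del: SF.simps)
  next
    fix A assume "A \<in> W_F \<O> ` FCF \<O>"
    then obtain c where "c \<in> FCF \<O>" "A = W_F \<O> c" by blast
    then have "SR c \<in> PCF \<O>" "A = W_P \<O> (SR c)"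
      using SR_in_PCF W_P_SR by auto
    then show "A \<in> W_P \<O> ` PCF \<O>" by blast
  qed
  then show ?thesis using W_F_surj by simp
qed

text \<open>\<open>PCF_rel\<close> is the pullback of \<open>FCF_rel\<close> along
  \<open>SF\<close>, so the kernel description of \<open>FCF_rel\<close> turns it into the kernel of
  \<open>W_P\<close>.\<close>

sublocale P: fibre_quotient "free_product (integer_mod_group 2) add_O" "PCF \<O>" "W_P \<O>"
  "\<lambda>P Q. SR (SF P @ SF Q)" "SR [0, 0]" "PCF_rel \<O>"
proof (intro fibre_quotient.intro fibre_quotient_axioms.intro)
  show "PCF_rel \<O> = {(P, Q). P \<in> PCF \<O> \<and> Q \<in> PCF \<O> \<and> W_P \<O> P = W_P \<O> Q}"
    by (auto simp: PCF_rel_def W_P_def FCF_rel_iff_W_F SF_in_FCF simp del: SF.simps)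
  show "SR [0, 0] \<in> PCF \<O>"
    by (intro SR_in_PCF F.e_closed)
  show "W_P \<O> (SR [0, 0]) = \<one>\<^bsub>free_product (integer_mod_group 2) add_O\<^esub>"
    by (simp only: W_P_SR F.e_closed F.f_e)
  fix P Q assume "P \<in> PCF \<O>" "Q \<in> PCF \<O>"
  then have "SF P \<in> FCF \<O>" "SF Q \<in> FCF \<O>"
    by (simp_all add: SF_in_FCF)
  then show "W_P \<O> (SR (SF P @ SF Q)) =
      W_P \<O> P \<otimes>\<^bsub>free_product (integer_mod_group 2) add_O\<^esub> W_P \<O> Q"
    by (simp only: W_P_SR FCF_append F.f_op) (simp add: W_P_def)
qed (rule fp.group_free_product W_P_surj SR_append_in_PCF; assumption)+

lemma quot_eq: "FCF_bar \<O> = F.quot" "PCF_bar \<O> = P.quot"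
  by (simp_all add: FCF_bar_def F.quot_def PCF_bar_def P.quot_def PCF_star_def)

end

theorem theorem4p9:
  fixes \<O> :: "complex set"
  assumes "subring \<O> complex_ring"
  shows
    "equiv (FCF \<O>) (FCF_rel \<O>)
      \<and> (\<lambda>c d. FCF_rel \<O> `` {c @ d}) respects2 (FCF_rel \<O>)
      \<and> equiv (PCF \<O>) (PCF_rel \<O>)
      \<and> (\<forall>P\<in>PCF \<O>. \<forall>P'\<in>PCF \<O>. SR (SF P @ SF P') \<in> PCF \<O>)
      \<and> PCF_star \<O> respects2 (PCF_rel \<O>)
      \<and> group (PCF_bar \<O>)
      \<and> group (FCF_bar \<O>)
      \<and> group (Z2_free_product \<O>)
      \<and> PCF_bar \<O> \<cong> FCF_bar \<O>
      \<and> FCF_bar \<O> \<cong> Z2_free_product \<O>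
      \<and> W_P \<O> respects (PCF_rel \<O>)
      \<and> (\<forall>P\<in>PCF \<O>. W_P_bar \<O> (PCF_rel \<O> `` {P}) = W_P \<O> P)
      \<and> W_P_bar \<O> \<in> iso (PCF_bar \<O>) (Z2_free_product \<O>)"
proof -
  interpret complex_subring \<O>
    using assms by (rule complex_subring.intro)
  have W_P_bar: "W_P_bar \<O> = (\<lambda>A. the_elem (W_P \<O> ` A))"
    by (simp add: fun_eq_iff W_P_bar_def)
  have PCF_star: "PCF_star \<O> = (\<lambda>P Q. PCF_rel \<O> `` {SR (SF P @ SF Q)})"
    by (simp add: fun_eq_iff PCF_star_def)
  \<comment> \<open>The isomorphism passes through the free product: \<open>W_P\<close> on classes,
    then fibres of \<open>W_F\<close>.\<close>
  have "PCF_bar \<O> \<cong> FCF_bar \<O>"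
    using is_isoI [OF P.the_elem_iso] is_isoI [OF F.fibre_iso] unfolding quot_eq
    by (rule iso_trans)
  moreover have "FCF_bar \<O> \<cong> Z2_free_product \<O>"
    using is_isoI [OF F.the_elem_iso] unfolding quot_eq add_O_def .
  moreover have "W_P_bar \<O> \<in> iso (PCF_bar \<O>) (Z2_free_product \<O>)"
    using P.the_elem_iso unfolding quot_eq W_P_bar add_O_def .
  moreover have "\<forall>P\<in>PCF \<O>. W_P_bar \<O> (PCF_rel \<O> `` {P}) = W_P \<O> P"
    unfolding W_P_bar using P.the_elem_class by blast
  moreover have "PCF_star \<O> respects2 (PCF_rel \<O>)"
    unfolding PCF_star by (rule P.respects2)
  moreover have "group (PCF_bar \<O>)" "group (FCF_bar \<O>)"
    unfolding quot_eq by (rule P.group_quot F.group_quot)+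
  moreover have "group (Z2_free_product \<O>)"
    using fp.group_free_product unfolding add_O_def .
  ultimately show ?thesis
    using F.equiv_r F.respects2 P.equiv_r P.respects SR_append_in_PCF by simp
qed

end
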